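(* Let $m\ge 0$, let $\Gamma'\subset V_m$, and let $x,y\in\Gamma'$ be distinct. Then $c^{\Gamma'}_{x,y}=0$ if and only if every path in the graph $\Gamma=V_m$ from $x$ to $y$ contains a point of $\Gamma'\setminus\{x,y\}$.
   Context: Let $q_0,q_1,q_2$ be the vertices of an equilateral triangle in the plane, $F_i(x)=\frac12(x+q_i)$, and let $SG$ (the Sierpinski gasket) be the unique nonempty compact set with $SG=\bigcup_{i}F_i(SG)$. For a word $w=w_1\cdots w_m$ let $F_w=F_{w_1}\circ\cdots\circ F_{w_m}$. Put $V_0=\{q_0,q_1,q_2\}$, $V_m=\bigcup_iF_iV_{m-1}$; $x\sim_m y$ means $x\ne y$ and $x,y\in F_wV_0$ for some word $w$ of length $m$. $V_m$ is regarded as a graph with edge relation $\sim_m$; a path is a finite sequence of points of $V_m$ in which consecutive points are joined by edges. The energy of a continuous $u:SG\to\mathbb{R}$ is $\mathcal{E}(u)=\lim_{m\to\infty}\left(\frac53\right)^m\sum_{\{x,y\}:x\sim_m y}(u(x)-u(y))^2$ (a nondecreasing limit), and $\operatorname{dom}\mathcal{E}$ is the set of continuous $u$ with $\mathcal{E}(u)<\infty$. For a nonempty set $A\subset V_m$ and values prescribed on $A$, there is a unique $u\in\operatorname{dom}\mathcal{E}$ of least energy with these values on $A$, and its energy has the form $\mathcal{E}(u)=\sum_{\{x,y\}\subset A}c^A_{x,y}(u(x)-u(y))^2$; the (uniquely determined, symmetric) coefficients $c^A_{x,y}$, $x\neq y$, are the conductances of $A$. *)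

theory Defs
  imports "HOL-Analysis.Analysis"
begin

text \<open>A triangle is given by \<open>q :: nat \<Rightarrow> real^2\<close>, of which only \<open>q 0\<close>, \<open>q 1\<close>, \<open>q 2\<close> are used;
  words are lists over \<open>{0, 1, 2}\<close>.\<close>

definition equilateral :: "(nat \<Rightarrow> real^2) \<Rightarrow> bool" where
  "equilateral q \<longleftrightarrow> q 0 \<noteq> q 1 \<and> dist (q 0) (q 1) = dist (q 1) (q 2) \<and> dist (q 1) (q 2) = dist (q 2) (q 0)"

definition sg_map :: "(nat \<Rightarrow> real^2) \<Rightarrow> nat \<Rightarrow> real^2 \<Rightarrow> real^2" where
  "sg_map q i x = (1/2) *\<^sub>R (x + q i)"

definition SG :: "(nat \<Rightarrow> real^2) \<Rightarrow> (real^2) set" where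
  "SG q = (THE K. K \<noteq> {} \<and> compact K \<and> K = (\<Union>i<3. sg_map q i ` K))"

primrec sg_word_map :: "(nat \<Rightarrow> real^2) \<Rightarrow> nat list \<Rightarrow> real^2 \<Rightarrow> real^2" where
  "sg_word_map q [] = id"
| "sg_word_map q (i # w) = sg_map q i \<circ> sg_word_map q w"

primrec sg_V :: "(nat \<Rightarrow> real^2) \<Rightarrow> nat \<Rightarrow> (real^2) set" where
  "sg_V q 0 = {q 0, q 1, q 2}"
| "sg_V q (Suc m) = (\<Union>i<3. sg_map q i ` sg_V q m)"

definition sg_adj :: "(nat \<Rightarrow> real^2) \<Rightarrow> nat \<Rightarrow> real^2 \<Rightarrow> real^2 \<Rightarrow> bool" where
  "sg_adj q m x y \<longleftrightarrow> x \<noteq> y \<and>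
     (\<exists>w. length w = m \<and> set w \<subseteq> {..<3} \<and>
          x \<in> sg_word_map q w ` sg_V q 0 \<and> y \<in> sg_word_map q w ` sg_V q 0)"

definition sg_path :: "(nat \<Rightarrow> real^2) \<Rightarrow> nat \<Rightarrow> real^2 \<Rightarrow> real^2 \<Rightarrow> (real^2) list \<Rightarrow> bool" where
  "sg_path q m x y p \<longleftrightarrow>
     p \<noteq> [] \<and> set p \<subseteq> sg_V q m \<and> successively (sg_adj q m) p \<and> hd p = x \<and> last p = y"

text \<open>Sums over unordered pairs \<open>{x, y}\<close> are written as half the sum over ordered pairs \<open>(x, y)\<close>.\<close>

definition sg_energy_level :: "(nat \<Rightarrow> real^2) \<Rightarrow> nat \<Rightarrow> (real^2 \<Rightarrow> real) \<Rightarrow> real" where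
  "sg_energy_level q m u =
     (5/3) ^ m * ((1/2) * (\<Sum>(x, y) \<in> {(x, y). sg_adj q m x y}. (u x - u y)\<^sup>2))"

text \<open>A function on \<open>SG q\<close> is represented by a function on the plane; its values off \<open>SG q\<close>
  play no role.\<close>

definition sg_energy :: "(nat \<Rightarrow> real^2) \<Rightarrow> (real^2 \<Rightarrow> real) \<Rightarrow> ereal" where
  "sg_energy q u = lim (\<lambda>m. ereal (sg_energy_level q m u))"

definition sg_dom :: "(nat \<Rightarrow> real^2) \<Rightarrow> (real^2 \<Rightarrow> real) set" where
  "sg_dom q = {u. continuous_on (SG q) u \<and> sg_energy q u < \<infinity>}"

definition least_energy ::
  "(nat \<Rightarrow> real^2) \<Rightarrow> (real^2) set \<Rightarrow> (real^2 \<Rightarrow> real) \<Rightarrow> (real^2 \<Rightarrow> real) \<Rightarrow> bool" where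
  "least_energy q A f u \<longleftrightarrow> u \<in> sg_dom q \<and> (\<forall>x\<in>A. u x = f x) \<and>
     (\<forall>v\<in>sg_dom q. (\<forall>x\<in>A. v x = f x) \<longrightarrow> sg_energy q u \<le> sg_energy q v)"

text \<open>The coefficients \<open>c x y\<close> matter only for distinct \<open>x, y \<in> A\<close>; all others are
  normalised to \<open>0\<close>, so that \<open>c\<close> is unique as a total function.\<close>

definition conductance :: "(nat \<Rightarrow> real^2) \<Rightarrow> (real^2) set \<Rightarrow> real^2 \<Rightarrow> real^2 \<Rightarrow> real" where
  "conductance q A = (THE c.
     (\<forall>x y. c x y = c y x) \<and>
     (\<forall>x y. x \<notin> A \<or> y \<notin> A \<or> x = y \<longrightarrow> c x y = 0) \<and>
     (\<forall>f u. least_energy q A f u \<longrightarrow>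
        sg_energy q u = ereal ((1/2) * (\<Sum>x\<in>A. \<Sum>y\<in>A. c x y * (u x - u y)\<^sup>2))))"

end

(* The least energy with prescribed values on V_m is the energy of the finite network V_m: energies
   increase with the level, and gluing harmonic functions on the cells extends any function on V_m
   without changing the energy. So the conductances of A are those of the trace of the network V_m
   on A. Removing one vertex z replaces the conductances by c x y + c x z * c z y / (sum of c t z),
   which is positive iff x and y were joined directly or through z; by induction the trace joins x
   and y iff some path from x to y has its interior outside A. *)
theory Submission
  imports Defs
begin

section \<open>Traces of finite electrical networks\<close>

text \<open>No cancellation can occur: eliminating a vertex only adds nonnegative terms, so the zero
  pattern of the conductances can be followed by itself, and reachability avoiding a set obeys the
  same recursion. On the gasket, minimisers are not found by compactness. The lower bound given by
  \<open>V_m\<close> is attained by an explicit continuous function, built from harmonic functions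
  that are uniform limits of piecewise affine ones. The factor 5/3 is exactly what makes this free
  of charge: subdividing a triangle and choosing the midpoint values optimally multiplies the sum of
  squares by 3/5. Refinement is always done one level at a time, through the three cells of level
  one. This rests on one geometric fact: distinct cells meet at most in the junction
  \<open>F_i q_j = F_j q_i\<close>. It keeps their edges disjoint and makes gluing well defined. As
  \<open>SG\<close> and \<open>conductance\<close> are definite descriptions, each also needs a
  uniqueness proof.\<close>

definition network_energy :: "'a set \<Rightarrow> ('a \<Rightarrow> 'a \<Rightarrow> real) \<Rightarrow> ('a \<Rightarrow> real) \<Rightarrow> real" where
  "network_energy V c u = (1/2) * (\<Sum>x\<in>V. \<Sum>y\<in>V. c x y * (u x - u y)\<^sup>2)"

text \<open>An isolated \<open>z\<close> is covered by \<open>0 / 0 = 0\<close>.\<close>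

definition star_mesh :: "'a set \<Rightarrow> 'a \<Rightarrow> ('a \<Rightarrow> 'a \<Rightarrow> real) \<Rightarrow> 'a \<Rightarrow> 'a \<Rightarrow> real" where
  "star_mesh V z c x y = c x y + c x z * c z y / (\<Sum>t\<in>V. c t z)"

text \<open>The end points belong to the admissible set, so a walk may revisit them: the theorem
  forbids only the other points of the retained set. The closure form suits induction on
  \<open>S\<close>.\<close>

definition joined_through :: "('a \<Rightarrow> 'a \<Rightarrow> bool) \<Rightarrow> 'a set \<Rightarrow> 'a \<Rightarrow> 'a \<Rightarrow> bool" where
  "joined_through R S x y \<longleftrightarrow>
     (\<lambda>a b. a \<in> insert x (insert y S) \<and> b \<in> insert x (insert y S) \<and> R a b)\<^sup>*\<^sup>* x y"

lemma network_energy_cong: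
  assumes "\<And>x. x \<in> V \<Longrightarrow> u x = v x"
  shows "network_energy V c u = network_energy V c v"
  unfolding network_energy_def using assms by (auto intro!: sum.cong)

text \<open>Completing the square in \<open>t\<close>: a weighted second moment about
  \<open>t\<close> is the one about the weighted mean plus \<open>s\<close> times the squared shift,
  and the former is a sum over pairs.\<close>

lemma star_energy:
  fixes w u :: "'a \<Rightarrow> real"
  assumes "finite V" and s: "s = (\<Sum>x\<in>V. w x)" and "s \<noteq> 0"
  shows "(\<Sum>x\<in>V. w x * (u x - t)\<^sup>2) =
    (1/2) * (\<Sum>x\<in>V. \<Sum>y\<in>V. w x * w y / s * (u x - u y)\<^sup>2)
      + s * (t - (\<Sum>x\<in>V. w x * u x) / s)\<^sup>2"
proof -
  define a where "a = (\<Sum>x\<in>V. w x * u x)"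
  define b where "b = (\<Sum>x\<in>V. w x * (u x)\<^sup>2)"
  have 1: "(\<Sum>x\<in>V. w x * (u x - t)\<^sup>2) = b - 2 * t * a + t\<^sup>2 * s"
    unfolding a_def b_def s sum_distrib_left sum_subtractf [symmetric] sum.distrib [symmetric]
    by (rule sum.cong) (auto simp: power2_eq_square algebra_simps)
  have "(\<Sum>x\<in>V. \<Sum>y\<in>V. w x * w y * (u x - u y)\<^sup>2)
     = (\<Sum>x\<in>V. \<Sum>y\<in>V. w x * (u x)\<^sup>2 * w y - 2 * ((w x * u x) * (w y * u y)) + w x * (w y * (u y)\<^sup>2))"
    by (intro sum.cong refl) (auto simp: power2_eq_square algebra_simps)
  also have "\<dots> = b * s - 2 * (a * a) + s * b"
    unfolding a_def b_def s sum_product sum.distrib sum_subtractf by (simp add: sum_distrib_left)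
  finally have 2: "(\<Sum>x\<in>V. \<Sum>y\<in>V. w x * w y * (u x - u y)\<^sup>2) = 2 * (b * s - a\<^sup>2)"
    by (simp add: power2_eq_square)
  have "(\<Sum>x\<in>V. \<Sum>y\<in>V. w x * w y / s * (u x - u y)\<^sup>2) = 2 * (b * s - a\<^sup>2) / s"
    unfolding 2 [symmetric] sum_divide_distrib by (intro sum.cong refl) auto
  moreover have "b - 2 * t * a + t\<^sup>2 * s = (b * s - a\<^sup>2) / s + s * (t - a / s)\<^sup>2"
    using \<open>s \<noteq> 0\<close> by (simp add: field_simps power2_eq_square)
  ultimately show ?thesis
    using 1 unfolding a_def by linarith
qed

lemma network_energy_insert:
  assumes "finite V" "z \<notin> V" "\<And>x y. c x y = c y x"
  shows "network_energy (insert z V) c u = network_energy V c u + (\<Sum>x\<in>V. c x z * (u x - u z)\<^sup>2)"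
proof -
  have "(\<Sum>y\<in>V. c z y * (u z - u y)\<^sup>2) = (\<Sum>y\<in>V. c y z * (u y - u z)\<^sup>2)"
    by (intro sum.cong refl) (metis assms(3) power2_commute)
  then show ?thesis
    using assms(1,2) by (simp add: network_energy_def sum.distrib algebra_simps)
qed

text \<open>The only term involving \<open>u z\<close> is a square that vanishes at the weighted
  mean, so minimising over \<open>u z\<close> leaves the \<open>star_mesh\<close> energy.\<close>

lemma network_energy_eliminate:
  fixes c :: "'a \<Rightarrow> 'a \<Rightarrow> real"
  assumes "finite V" "z \<notin> V" and sym: "\<And>x y. c x y = c y x" and nonneg: "\<And>x y. c x y \<ge> 0"
  defines "s \<equiv> (\<Sum>t\<in>V. c t z)"
  shows "network_energy (insert z V) c u =
    network_energy V (star_mesh V z c) u + s * (u z - (\<Sum>x\<in>V. c x z * u x) / s)\<^sup>2"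
proof (cases "s = 0")
  case True
  then have "\<forall>x\<in>V. c x z = 0"
    using assms(1) nonneg unfolding s_def by (simp add: sum_nonneg_eq_0_iff)
  with True show ?thesis
    using network_energy_insert [where c = c, OF assms(1,2) sym]
    by (simp add: network_energy_def star_mesh_def s_def)
next
  case False
  have "network_energy V (star_mesh V z c) u = network_energy V c u
      + (1/2) * (\<Sum>x\<in>V. \<Sum>y\<in>V. c x z * c y z / s * (u x - u y)\<^sup>2)"
    unfolding network_energy_def star_mesh_def s_def [symmetric] sym [of z]
    by (simp add: algebra_simps sum.distrib)
  then show ?thesis
    using network_energy_insert [where c = c, OF assms(1,2) sym, where u = u]
      star_energy [OF assms(1) s_def [THEN meta_eq_to_obj_eq] False, where u = u and t = "u z"]
    by linarith
qed

text \<open>The recursion step of the Floyd--Warshall algorithm.\<close>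

lemma joined_through_insert:
  assumes z: "z \<notin> S"
  shows "joined_through R (insert z S) x y \<longleftrightarrow>
    joined_through R S x y \<or> joined_through R S x z \<and> joined_through R S z y"
    (is "?L \<longleftrightarrow> ?R")
proof
  define P where "P T a b \<longleftrightarrow> a \<in> T \<and> b \<in> T \<and> R a b" for T and a b
  have J: "joined_through R S a b \<longleftrightarrow> (P (insert a (insert b S)))\<^sup>*\<^sup>* a b" for S a b
    unfolding joined_through_def P_def ..
  have mono: "(P T)\<^sup>*\<^sup>* a b \<Longrightarrow> T \<subseteq> T' \<Longrightarrow> (P T')\<^sup>*\<^sup>* a b" for T T' a b
    using rtranclp_mono [of "P T" "P T'"] unfolding P_def by blast
  { assume ?R
    then show ?L
    proof (elim disjE conjE)
      assume "joined_through R S x y"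
      then show ?L unfolding J by (rule mono) auto
    next
      assume "joined_through R S x z" "joined_through R S z y"
      then have "(P (insert x (insert y (insert z S))))\<^sup>*\<^sup>* x z" "(P (insert x (insert y (insert z S))))\<^sup>*\<^sup>* z y"
        unfolding J by (auto elim: mono)
      then show ?L unfolding J by simp
    qed }
  assume ?L
  then have "(P (insert x (insert y (insert z S))))\<^sup>*\<^sup>* x y" unfolding J .
  \<comment> \<open>Invariant along the walk: only the part since the last visit to \<open>x\<close>
    or \<open>z\<close> is remembered. A return to \<open>x\<close> starts afresh, and reaching
    \<open>y\<close> gives \<open>?R\<close> at once.\<close>
  moreover have "?R \<or> b = x \<or> (b = z \<and> joined_through R S x z)
      \<or> (b \<in> S \<and> ((P (insert x S))\<^sup>*\<^sup>* x b \<or> joined_through R S x z \<and> (P (insert z S))\<^sup>*\<^sup>* z b))"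
    if "(P (insert x (insert y (insert z S))))\<^sup>*\<^sup>* x b" for b
    using that
  proof induction
    case base
    show ?case by blast
  next
    case (step b b')
    \<comment> \<open>Appends one edge whose end \<open>d\<close> may lie outside \<open>S\<close>,
      as happens on arrival at \<open>x\<close>, \<open>y\<close> or \<open>z\<close>.\<close>
    have ext: "(P (insert e (insert d S)))\<^sup>*\<^sup>* e d"
      if "(P (insert e S))\<^sup>*\<^sup>* e b" "b \<in> insert e S" "R b d" for e d
    proof -
      have "(P (insert e (insert d S)))\<^sup>*\<^sup>* e b" using that(1) by (rule mono) auto
      moreover have "P (insert e (insert d S)) b d" using that unfolding P_def by auto
      ultimately show ?thesis by (rule rtranclp.rtrancl_into_rtrancl)
    qed
    have R: "R b b'" and b': "b' = x \<or> b' = y \<or> b' = z \<or> b' \<in> S"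
      using step.hyps(2) unfolding P_def by auto
    have ins: "b' \<in> S \<Longrightarrow> insert e (insert b' S) = insert e S" for e by auto
    from step.IH consider "?R" | "b = x" | "b = z" "joined_through R S x z"
      | "b \<in> S" "(P (insert x S))\<^sup>*\<^sup>* x b"
      | "b \<in> S" "joined_through R S x z" "(P (insert z S))\<^sup>*\<^sup>* z b" by blast
    then show ?case
    proof cases
      case 1
      then show ?thesis by blast
    next
      case 2
      then show ?thesis using ext [of x b'] R b' ins [of x] by (auto simp: J)
    next
      case 3
      then show ?thesis using ext [of z b'] R b' ins [of z] by (auto simp: J)
    next
      case 4
      then show ?thesis using ext [of x b'] R b' ins [of x] by (auto simp: J)
    next
      case 5
      then show ?thesis using ext [of z b'] R b' ins [of z] by (auto simp: J)
    qed
  qed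
  \<comment> \<open>The end point \<open>y\<close> may coincide with \<open>x\<close> or
    \<open>z\<close> or lie in \<open>S\<close>; these degenerate cases are settled below.\<close>
  ultimately have D: "?R \<or> y = x \<or> (y = z \<and> joined_through R S x z)
      \<or> (y \<in> S \<and> ((P (insert x S))\<^sup>*\<^sup>* x y \<or> joined_through R S x z \<and> (P (insert z S))\<^sup>*\<^sup>* z y))"
    by blast
  have refl: "joined_through R S a a" for a unfolding J by simp
  from D consider "?R" | "y = x" | "y = z" "joined_through R S x z"
    | "y \<in> S" "(P (insert x S))\<^sup>*\<^sup>* x y"
    | "y \<in> S" "joined_through R S x z" "(P (insert z S))\<^sup>*\<^sup>* z y" by blast
  then show ?R
  proof cases
    case 4
    then have "joined_through R S x y" unfolding J by (auto elim: mono)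
    then show ?thesis by blast
  next
    case 5
    then have "joined_through R S z y" unfolding J by (auto elim: mono)
    then show ?thesis using 5 by blast
  qed (use refl in auto)
qed

lemma joined_through_empty:
  "x \<noteq> y \<Longrightarrow> (\<And>a b. R a b \<Longrightarrow> R b a) \<Longrightarrow> joined_through R {} x y \<longleftrightarrow> R x y"
proof
  assume ne: "x \<noteq> y" and "joined_through R {} x y"
  then have "(\<lambda>a b. a \<in> {x, y} \<and> b \<in> {x, y} \<and> R a b)\<^sup>*\<^sup>* x y" unfolding joined_through_def by simp
  then have "y = x \<or> R x y"
    by (induction) auto
  with ne show "R x y" by simp
qed (auto simp: joined_through_def)

text \<open>The two energy clauses (a lower bound, and its attainment) say that the energy of
  \<open>c'\<close> is the minimum of that of \<open>c\<close> under prescribed values on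
  \<open>T\<close>. Elimination can create diagonal entries, which the energy does not see; hence
  \<open>x \<noteq> y\<close> in the clause on positivity.\<close>

definition trace_conductances ::
    "('a \<Rightarrow> 'a \<Rightarrow> real) \<Rightarrow> 'a set \<Rightarrow> 'a set \<Rightarrow> ('a \<Rightarrow> 'a \<Rightarrow> real) \<Rightarrow> bool" where
  "trace_conductances c S T c' \<longleftrightarrow>
    (\<forall>x y. c' x y = c' y x) \<and> (\<forall>x y. c' x y \<ge> 0) \<and>
    (\<forall>u. network_energy T c' u \<le> network_energy (S \<union> T) c u) \<and>
    (\<forall>u. \<exists>v. (\<forall>x\<in>T. v x = u x) \<and> network_energy (S \<union> T) c v = network_energy T c' u) \<and>
    (\<forall>x\<in>T. \<forall>y\<in>T. x \<noteq> y \<longrightarrow> (c' x y > 0 \<longleftrightarrow> joined_through (\<lambda>a b. c a b > 0) S x y))"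

text \<open>The induction hypothesis is applied with \<open>z\<close> still retained, and
  \<open>z\<close> is then removed by one star-mesh step; this is why \<open>T\<close> is
  generalised.\<close>

lemma trace_conductances_exist:
  fixes c :: "'a \<Rightarrow> 'a \<Rightarrow> real"
  assumes "finite S" "finite T" "S \<inter> T = {}"
    and sym: "\<And>x y. c x y = c y x" and nonneg: "\<And>x y. c x y \<ge> 0"
  shows "\<exists>c'. trace_conductances c S T c'"
  using assms(1-3)
proof (induction S arbitrary: T)
  case empty
  have "joined_through (\<lambda>a b. c a b > 0) {} x y \<longleftrightarrow> c x y > 0" if "x \<noteq> y" for x y
    by (rule joined_through_empty [OF that]) (simp add: sym)
  then show ?case
    using sym nonneg unfolding trace_conductances_def by (intro exI [of _ c]) auto
next
  case (insert z S)
  have fin: "finite (insert z T)" "S \<inter> insert z T = {}"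
    using insert.prems insert.hyps by auto
  obtain c1 where tr: "trace_conductances c S (insert z T) c1"
    using insert.IH [OF fin] by blast
  have Un: "S \<union> insert z T = insert z S \<union> T" by auto
  note tr' = tr [unfolded trace_conductances_def Un]
  note c1 = tr' [THEN conjunct1, rule_format] tr' [THEN conjunct2, THEN conjunct1, rule_format]
    tr' [THEN conjunct2, THEN conjunct2, THEN conjunct1, rule_format]
    tr' [THEN conjunct2, THEN conjunct2, THEN conjunct2, THEN conjunct1, rule_format]
    tr' [THEN conjunct2, THEN conjunct2, THEN conjunct2, THEN conjunct2, rule_format]
  have z: "z \<notin> T" using insert.prems by auto
  define c' where "c' = star_mesh T z c1"
  define s where "s = (\<Sum>t\<in>T. c1 t z)"
  have s: "s \<ge> 0" unfolding s_def using c1(2) by (simp add: sum_nonneg)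
  have elim: "network_energy (insert z T) c1 u =
      network_energy T c' u + s * (u z - (\<Sum>x\<in>T. c1 x z * u x) / s)\<^sup>2" for u
    using network_energy_eliminate [where c = c1, OF insert.prems(1) z c1(1) c1(2)]
    unfolding c'_def s_def by simp
  have "network_energy T c' u \<le> network_energy (insert z S \<union> T) c u" for u
    using order_trans [OF _ c1(3)] elim [of u] s by simp
  moreover have "\<exists>v. (\<forall>x\<in>T. v x = u x) \<and>
      network_energy (insert z S \<union> T) c v = network_energy T c' u" for u
  proof -
    \<comment> \<open>The weighted mean of the neighbours makes the extra square in
      \<open>elim\<close> vanish.\<close>
    define u' where "u' = u(z := (\<Sum>x\<in>T. c1 x z * u x) / s)"
    have eq: "u' x = u x" if "x \<in> T" for x using that z unfolding u'_def by auto
    have "(\<Sum>x\<in>T. c1 x z * u' x) = (\<Sum>x\<in>T. c1 x z * u x)"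
      by (intro sum.cong) (auto simp: eq)
    then have "network_energy (insert z T) c1 u' = network_energy T c' u'"
      unfolding elim by (simp add: u'_def)
    also have "\<dots> = network_energy T c' u" by (rule network_energy_cong) (rule eq)
    finally show ?thesis using c1(4) [of u'] eq by auto
  qed
  moreover have "c' x y > 0 \<longleftrightarrow> joined_through (\<lambda>a b. c a b > 0) (insert z S) x y"
    if xy: "x \<in> T" "y \<in> T" "x \<noteq> y" for x y
  proof -
    \<comment> \<open>If \<open>s = 0\<close> the quotient is 0 by convention, consistently with all
      \<open>c1 t z\<close> being 0.\<close>
    have "c1 x z * c1 z y / s > 0 \<longleftrightarrow> c1 x z > 0 \<and> c1 z y > 0"
    proof
      assume "c1 x z > 0 \<and> c1 z y > 0"
      moreover from this have "s > 0"
        unfolding s_def using c1(2) xy(1) insert.prems(1)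
        by (meson sum_pos2)
      ultimately show "c1 x z * c1 z y / s > 0" by simp
    next
      assume "c1 x z * c1 z y / s > 0"
      then have "c1 x z \<noteq> 0" "c1 z y \<noteq> 0" by auto
      then show "c1 x z > 0 \<and> c1 z y > 0" using c1(2) by (simp add: less_le)
    qed
    moreover have "c1 x z * c1 z y / s \<ge> 0" using c1(2) s by simp
    ultimately have "c' x y > 0 \<longleftrightarrow> c1 x y > 0 \<or> c1 x z > 0 \<and> c1 z y > 0"
      unfolding c'_def star_mesh_def s_def [symmetric]
      using c1(2)[of x y] by linarith
    also have "\<dots> \<longleftrightarrow> joined_through (\<lambda>a b. c a b > 0) (insert z S) x y"
      unfolding joined_through_insert [OF insert.hyps(2)]
      using c1(5) [of x y] c1(5) [of x z] c1(5) [of z y] xy z by auto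
    finally show ?thesis .
  qed
  moreover have "c' x y = c' y x" "c' x y \<ge> 0" for x y
    unfolding c'_def star_mesh_def s_def [symmetric] c1(1) [of y x] c1(1) [of z] using c1(2) s by (simp_all add: mult.commute)
  ultimately show ?case
    unfolding trace_conductances_def by (intro exI [of _ c'] conjI allI ballI impI)
qed

section \<open>Recovering the conductances from the energy\<close>

lemma network_energy_indicator:
  assumes "finite V" "X \<subseteq> V" and sym: "\<And>x y. c x y = c y x"
  shows "network_energy V c (indicator X) = (\<Sum>x\<in>X. \<Sum>y\<in>V-X. c x y)"
proof -
  let ?i = "indicator X :: 'a \<Rightarrow> real"
  have V: "V = X \<union> (V - X)" and fin: "finite X" "finite (V - X)"
    using assms finite_subset by auto
  have spl: "(\<Sum>x\<in>V. g x) = (\<Sum>x\<in>X. g x) + (\<Sum>x\<in>V-X. g x)" for g :: "'a \<Rightarrow> real"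
    using sum.union_disjoint [OF fin, of g] V by auto
  have 1: "(\<Sum>y\<in>V. c x y * (?i x - ?i y)\<^sup>2) = (\<Sum>y\<in>V-X. c x y)" if "x \<in> X" for x
    using that unfolding spl by (simp add: indicator_def)
  have 2: "(\<Sum>y\<in>V. c x y * (?i x - ?i y)\<^sup>2) = (\<Sum>y\<in>X. c x y)" if "x \<in> V - X" for x
    using that unfolding spl by (simp add: indicator_def)
  have "network_energy V c ?i = (1/2) * ((\<Sum>x\<in>X. \<Sum>y\<in>V-X. c x y) + (\<Sum>x\<in>V-X. \<Sum>y\<in>X. c x y))"
    unfolding network_energy_def spl [of "\<lambda>x. \<Sum>y\<in>V. c x y * (?i x - ?i y)\<^sup>2"] using 1 2 by simp
  also have "(\<Sum>x\<in>V-X. \<Sum>y\<in>X. c x y) = (\<Sum>x\<in>X. \<Sum>y\<in>V-X. c x y)"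
    by (subst sum.swap) (simp add: sym)
  finally show ?thesis by simp
qed

text \<open>Polarisation with cut weights: the edge between \<open>x\<close> and \<open>y\<close> is
  counted in the cut of \<open>{x}\<close> and in that of \<open>{y}\<close> but not in that of
  \<open>{x, y}\<close>; all other edges cancel.\<close>

lemma conductances_unique:
  assumes "finite V" "x \<in> V" "y \<in> V" "x \<noteq> y"
    and sym: "\<And>x y. c x y = c y x" "\<And>x y. d x y = d y x"
    and eq: "\<And>u. network_energy V c u = network_energy V d u"
  shows "c x y = d x y"
proof -
  have *: "2 * e x y = network_energy V e (indicator {x}) + network_energy V e (indicator {y})
      - network_energy V e (indicator {x, y})"
    if sym: "\<And>x y. e x y = e y x" for e :: "'a \<Rightarrow> 'a \<Rightarrow> real"
  proof -
    have "(\<Sum>t\<in>V-{x}. e x t) = e x y + (\<Sum>t\<in>V-{x,y}. e x t)"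
      "(\<Sum>t\<in>V-{y}. e y t) = e y x + (\<Sum>t\<in>V-{x,y}. e y t)"
      using assms(1-4) sum.remove [of "V-{x}" y "e x"] sum.remove [of "V-{y}" x "e y"]
      by (auto simp: Diff_insert [symmetric] insert_commute)
    then show ?thesis
      using assms(1-4) sym by (simp add: network_energy_indicator)
  qed
  show ?thesis using * [of c] * [of d] sym eq by simp
qed

section \<open>The Sierpinski gasket\<close>

lemma less_3_cases: "(i::nat) < 3 \<longleftrightarrow> i = 0 \<or> i = 1 \<or> i = 2"
  by auto

lemma lessThan_3: "{..<3::nat} = {0, 1, 2}"
  by auto

lemma dist_sg_map: "dist (sg_map q i x) (sg_map q i y) = dist x y / 2"
proof -
  have "sg_map q i x - sg_map q i y = (1/2) *\<^sub>R (x - y)"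
    by (simp add: sg_map_def algebra_simps)
  then show ?thesis by (simp add: dist_norm)
qed

lemma sg_map_inject [simp]: "sg_map q i x = sg_map q i y \<longleftrightarrow> x = y"
  by (simp add: sg_map_def)

lemma sg_map_fixed [simp]: "sg_map q i (q i) = q i"
  by (simp add: sg_map_def flip: scaleR_2)

lemma sg_map_corner_commute: "sg_map q i (q j) = sg_map q j (q i)"
  by (simp add: sg_map_def add.commute)

lemma continuous_on_sg_map: "continuous_on A (sg_map q i)"
  unfolding sg_map_def by (intro continuous_intros)

lemma finite_sg_V: "finite (sg_V q m)"
  by (induction m) auto

lemma corner_in_sg_V: "i < 3 \<Longrightarrow> q i \<in> sg_V q m"
proof (induction m)
  case (Suc m)
  then have "sg_map q i (q i) \<in> sg_V q (Suc m)" by (auto simp del: sg_map_fixed)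
  then show ?case by simp
qed (auto simp: less_3_cases)

lemma sg_map_in_sg_V: "i < 3 \<Longrightarrow> x \<in> sg_V q m \<Longrightarrow> sg_map q i x \<in> sg_V q (Suc m)"
  by auto

lemma sg_V_induct [consumes 1, case_names corner map]:
  assumes "x \<in> sg_V q m" "\<And>i. i < 3 \<Longrightarrow> P (q i)"
    "\<And>i x. i < 3 \<Longrightarrow> P x \<Longrightarrow> P (sg_map q i x)"
  shows "P x"
  using assms(1)
proof (induction m arbitrary: x)
  case 0
  then show ?case using assms(2) [of 0] assms(2) [of 1] assms(2) [of 2] by auto
qed (use assms(3) in auto)

lemma sg_adj_0: "sg_adj q 0 x y \<longleftrightarrow> x \<noteq> y \<and> x \<in> sg_V q 0 \<and> y \<in> sg_V q 0"
  by (auto simp: sg_adj_def)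

lemma sg_adj_Suc:
  "sg_adj q (Suc m) x y \<longleftrightarrow>
    (\<exists>i<3. \<exists>x' y'. x = sg_map q i x' \<and> y = sg_map q i y' \<and> sg_adj q m x' y')" (is "?L \<longleftrightarrow> ?R")
proof
  assume ?L
  then obtain w where "x \<noteq> y" and w: "length w = Suc m" "set w \<subseteq> {..<3}"
    "x \<in> sg_word_map q w ` sg_V q 0" "y \<in> sg_word_map q w ` sg_V q 0"
    unfolding sg_adj_def by blast
  from w(1) obtain i v where v: "w = i # v" "length v = m" by (cases w) auto
  with w(3,4) obtain a b where ab: "a \<in> sg_V q 0" "b \<in> sg_V q 0"
    "x = sg_map q i (sg_word_map q v a)" "y = sg_map q i (sg_word_map q v b)" by auto
  then have "sg_adj q m (sg_word_map q v a) (sg_word_map q v b)"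
    unfolding sg_adj_def using v w(2) \<open>x \<noteq> y\<close> by auto
  then show ?R using ab(3,4) v w(2) by auto
next
  assume ?R
  then obtain i x' y' w where *: "i < 3" "x = sg_map q i x'" "y = sg_map q i y'" "x' \<noteq> y'"
    "length w = m" "set w \<subseteq> {..<3}"
    "x' \<in> sg_word_map q w ` sg_V q 0" "y' \<in> sg_word_map q w ` sg_V q 0"
    unfolding sg_adj_def by blast
  then show ?L
    unfolding sg_adj_def by (intro conjI exI [of _ "i # w"]) (auto simp del: sg_V.simps)
qed

lemma sg_adj_sym: "sg_adj q m x y \<Longrightarrow> sg_adj q m y x"
  unfolding sg_adj_def by blast

lemma sg_adj_neq: "sg_adj q m x y \<Longrightarrow> x \<noteq> y"
  unfolding sg_adj_def by blast

lemma sg_adj_in_sg_V: "sg_adj q m x y \<Longrightarrow> x \<in> sg_V q m \<and> y \<in> sg_V q m"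
proof (induction m arbitrary: x y)
  case (Suc m)
  then show ?case unfolding sg_adj_Suc by fastforce
qed (auto simp: sg_adj_0)

locale gasket =
  fixes q :: "nat \<Rightarrow> real^2"
  assumes equilateral: "equilateral q"
begin

section \<open>Barycentric coordinates and the enclosing triangle\<close>

definition side_sq :: real where
  "side_sq = (q 1 - q 0) \<bullet> (q 1 - q 0)"

definition centroid :: "real^2" where
  "centroid = (1/3) *\<^sub>R (q 0 + q 1 + q 2)"

text \<open>Barycentric coordinates: the vertices satisfy
  \<open>(q j - centroid) \<bullet> (q i - centroid) = side_sq / 3\<close> for \<open>i = j\<close> and \<open>- side_sq / 6\<close> otherwise.\<close>

definition bary :: "nat \<Rightarrow> real^2 \<Rightarrow> real" where
  "bary i x = 1/3 + 2 / side_sq * ((x - centroid) \<bullet> (q i - centroid))"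

lemma side_sq_pos: "side_sq > 0"
  using equilateral unfolding equilateral_def side_sq_def by auto

lemma bary_corner:
  assumes "i < 3" "j < 3"
  shows "bary i (q j) = (if i = j then 1 else 0)"
proof -
  define p where "p = q 1 - q 0"
  define r where "r = q 2 - q 0"
  have pp: "p \<bullet> p = side_sq" unfolding side_sq_def p_def ..
  have "dist (q 1) (q 2) = norm (p - r)" "dist (q 2) (q 0) = norm r" "dist (q 0) (q 1) = norm p"
    unfolding p_def r_def by (auto simp: dist_norm norm_minus_commute)
  with equilateral have "norm p = norm (p - r)" "norm p = norm r"
    unfolding equilateral_def by auto
  then have rr: "r \<bullet> r = side_sq" and "(p - r) \<bullet> (p - r) = side_sq"
    unfolding pp [symmetric] by (simp_all add: norm_eq)
  \<comment> \<open>Three equal sides force an angle of 60 degrees, so the inner product is half the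
    squared side.\<close>
  then have pr: "p \<bullet> r = side_sq / 2" "r \<bullet> p = side_sq / 2"
    using pp by (simp_all add: inner_diff inner_commute)
  have q: "q 0 - centroid = (-1/3) *\<^sub>R (p + r)" "q 1 - centroid = (2/3) *\<^sub>R p - (1/3) *\<^sub>R r"
    "q 2 - centroid = (2/3) *\<^sub>R r - (1/3) *\<^sub>R p"
    unfolding centroid_def p_def r_def by (simp_all add: vec_eq_iff field_simps)
  show ?thesis
    using assms side_sq_pos unfolding less_3_cases bary_def
    by (elim disjE) (simp_all add: q [simplified] inner_add inner_diff pp rr pr field_simps)
qed

lemma sum_bary: "(\<Sum>i<3. bary i x) = 1"
proof -
  have "(\<Sum>i<3. (x - centroid) \<bullet> (q i - centroid)) = (x - centroid) \<bullet> (\<Sum>i<3. q i - centroid)"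
    by (simp add: inner_sum_right)
  also have "(\<Sum>i<3. q i - centroid) = 0"
    unfolding lessThan_3 centroid_def by (simp add: vec_eq_iff, simp add: field_simps)
  finally show ?thesis
    unfolding bary_def sum.distrib sum_distrib_left [symmetric] by simp
qed

lemma bary_sg_map: "bary j (sg_map q i x) = (bary j x + bary j (q i)) / 2"
proof -
  have "sg_map q i x - centroid = (1/2) *\<^sub>R ((x - centroid) + (q i - centroid))"
    unfolding sg_map_def by (simp add: vec_eq_iff field_simps)
  moreover have "1/3 + 2 / s * (1/2 * (a + b)) = (1/3 + 2 / s * a + (1/3 + 2 / s * b)) / 2" for a b s :: real
    by (simp add: algebra_simps add_divide_distrib)
  ultimately show ?thesis
    unfolding bary_def by (simp only: inner_add_left inner_scaleR_left)
qed

lemma continuous_on_bary: "continuous_on A (bary i)"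
  unfolding bary_def by (intro continuous_intros)

text \<open>The second condition lets a point be read back from its coordinates. It is closed and
  preserved by the maps, so \<open>SG q\<close> inherits it from the corners without a basis
  argument in the plane.\<close>

definition triangle :: "(real^2) set" where
  "triangle = {x. (\<forall>i<3. bary i x \<ge> 0) \<and> (\<Sum>i<3. bary i x *\<^sub>R q i) = x}"

lemma closed_triangle: "closed triangle"
proof -
  have "triangle = (\<Inter>i<3. {x. bary i x \<ge> 0}) \<inter> {x. (\<Sum>i<3. bary i x *\<^sub>R q i) = x}"
    unfolding triangle_def by auto
  then show ?thesis
    by (auto intro!: closed_INT closed_Int closed_Collect_le closed_Collect_eq continuous_intros
        continuous_on_bary)
qed

lemma bary_le_1: "x \<in> triangle \<Longrightarrow> i < 3 \<Longrightarrow> bary i x \<le> 1"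
  unfolding sum_bary [of x, symmetric] triangle_def by (intro member_le_sum) auto

lemma bounded_triangle: "bounded triangle"
proof (rule boundedI)
  fix x assume x: "x \<in> triangle"
  then have "norm x = norm (\<Sum>i<3. bary i x *\<^sub>R q i)"
    unfolding triangle_def by auto
  also have "\<dots> \<le> (\<Sum>i<3. norm (bary i x *\<^sub>R q i))" by (rule norm_sum)
  also have "\<dots> \<le> (\<Sum>i<3. norm (q i))"
    using x bary_le_1 [OF x] unfolding triangle_def
    by (intro sum_mono) (auto intro!: mult_left_le_one_le)
  finally show "norm x \<le> (\<Sum>i<3. norm (q i))" .
qed

lemma sg_V_subset_triangle: "sg_V q m \<subseteq> triangle"
proof
  fix x assume "x \<in> sg_V q m"
  then show "x \<in> triangle"
  proof (induction rule: sg_V_induct)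
    case (corner i)
    then have "(\<Sum>j<3. bary j (q i) *\<^sub>R q j) = (\<Sum>j<3. if j = i then q j else 0)"
      by (intro sum.cong) (auto simp: bary_corner)
    then show ?case using corner by (auto simp: triangle_def bary_corner)
  next
    case (map i x)
    have "(\<Sum>j<3. bary j (q i) *\<^sub>R q j) = (\<Sum>j<3. if j = i then q j else 0)"
      using map(1) by (intro sum.cong) (auto simp: bary_corner)
    moreover have "(\<Sum>j<3. bary j (sg_map q i x) *\<^sub>R q j) =
        (1/2) *\<^sub>R ((\<Sum>j<3. bary j x *\<^sub>R q j) + (\<Sum>j<3. bary j (q i) *\<^sub>R q j))"
      unfolding sum.distrib [symmetric] scaleR_sum_right
      by (intro sum.cong refl) (simp add: bary_sg_map algebra_simps add_divide_distrib)
    ultimately have "(\<Sum>j<3. bary j (sg_map q i x) *\<^sub>R q j) = sg_map q i x"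
      using map unfolding triangle_def sg_map_def by simp
    then show ?case using map by (auto simp: triangle_def bary_sg_map bary_corner)
  qed
qed

section \<open>The gasket as the closure of the vertex sets\<close>

lemma compact_closure_sg_V: "compact (closure (\<Union>m. sg_V q m))"
proof -
  have "(\<Union>m. sg_V q m) \<subseteq> triangle" using sg_V_subset_triangle by blast
  then show ?thesis using bounded_subset [OF bounded_triangle] by (simp add: compact_closure)
qed

text \<open>One inclusion is continuity. For the other, the union of the three compact images is
  closed and contains every \<open>sg_V q m\<close>, because the vertex sets increase.\<close>

lemma sg_map_closure: "(\<Union>i<3. sg_map q i ` closure (\<Union>m. sg_V q m)) = closure (\<Union>m. sg_V q m)"
  (is "(\<Union>i<3. _ ` closure ?V) = _")
proof
  have *: "sg_map q i ` ?V \<subseteq> ?V" if "i < 3" for i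
    using sg_map_in_sg_V [OF that] by blast
  show "(\<Union>i<3. sg_map q i ` closure ?V) \<subseteq> closure ?V"
  proof (rule UN_least)
    fix i :: nat assume "i \<in> {..<3}"
    then have "sg_map q i ` ?V \<subseteq> closure ?V"
      using * [of i] closure_subset [of ?V] by blast
    then show "sg_map q i ` closure ?V \<subseteq> closure ?V"
      by (intro image_closure_subset continuous_on_sg_map closed_closure)
  qed
  have "closed (\<Union>i<3. sg_map q i ` closure ?V)"
    using compact_closure_sg_V
    by (intro closed_UN ballI compact_imp_closed compact_continuous_image continuous_on_sg_map) auto
  moreover have "?V \<subseteq> (\<Union>i<3. sg_map q i ` closure ?V)"
  proof (rule UN_least)
    fix m
    have "sg_V q m \<subseteq> sg_V q (Suc m)"
    proof
      fix x assume "x \<in> sg_V q m"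
      then show "x \<in> sg_V q (Suc m)"
      proof (induction m arbitrary: x)
        case 0
        then show ?case using corner_in_sg_V [of _ q "Suc 0"] by auto
      next
        case (Suc m)
        then show ?case by (subst sg_V.simps) fastforce
      qed
    qed
    also have "\<dots> \<subseteq> (\<Union>i<3. sg_map q i ` closure ?V)"
      unfolding sg_V.simps using closure_subset [of ?V] by (intro UN_mono image_mono) auto
    finally show "sg_V q m \<subseteq> \<dots>" .
  qed
  ultimately show "closure ?V \<subseteq> (\<Union>i<3. sg_map q i ` closure ?V)"
    by (rule closure_minimal [rotated])
qed

lemma SG_eq_closure: "SG q = closure (\<Union>m. sg_V q m)"
  unfolding SG_def
proof (rule the_equality)
  let ?V = "\<Union>m. sg_V q m"
  have "closure ?V \<noteq> {}" using corner_in_sg_V [of 0 q] by auto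
  then show "closure ?V \<noteq> {} \<and> compact (closure ?V) \<and> closure ?V = (\<Union>i<3. sg_map q i ` closure ?V)"
    using sg_map_closure compact_closure_sg_V by simp
next
  let ?V = "\<Union>m. sg_V q m"
  fix K assume "K \<noteq> {} \<and> compact K \<and> K = (\<Union>i<3. sg_map q i ` K)"
  then have ne: "K \<noteq> {}" and cpt: "compact K" and K: "K = (\<Union>i<3. sg_map q i ` K)" by auto
  have map: "sg_map q i x \<in> K" if "i < 3" "x \<in> K" for i x
    by (subst K) (use that in auto)
  have corner: "q i \<in> K" if "i < 3" for i
  proof -
    \<comment> \<open>Iterating one contraction on any point of \<open>K\<close> converges to its
      fixed point \<open>q i\<close>, which closedness puts into \<open>K\<close>.\<close>
    obtain k where k: "k \<in> K" using ne by auto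
    define s where "s n = (sg_map q i ^^ n) k" for n
    have "s n \<in> K" for n unfolding s_def by (induction n) (auto simp: k map that)
    moreover have "s \<longlonglongrightarrow> q i"
    proof -
      have d: "dist (s n) (q i) = dist k (q i) * (1/2) ^ n" for n
      proof (induction n)
        case (Suc n)
        have "dist (s (Suc n)) (q i) = dist (s n) (q i) / 2"
          using dist_sg_map [of q i "s n" "q i"] by (simp add: s_def)
        then show ?case using Suc by simp
      qed (simp add: s_def)
      have "(\<lambda>n. dist k (q i) * (1/2) ^ n) \<longlonglongrightarrow> dist k (q i) * 0"
        by (intro tendsto_intros LIMSEQ_power_zero) simp
      then show ?thesis unfolding tendsto_dist_iff [of s] d by simp
    qed
    ultimately show ?thesis
      using compact_imp_closed [OF cpt] closed_sequentially by blast
  qed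
  have "?V \<subseteq> K"
  proof clarify
    fix x m assume "x \<in> sg_V q m"
    then show "x \<in> K" by (induction rule: sg_V_induct) (auto simp: corner map)
  qed
  then have "closure ?V \<subseteq> K"
    using compact_imp_closed [OF cpt] by (rule closure_minimal)
  moreover have "K \<subseteq> closure ?V"
  proof
    fix x assume x: "x \<in> K"
    obtain M where M: "\<forall>y\<in>K. dist (q 0) y \<le> M"
      using compact_imp_bounded [OF cpt] unfolding bounded_any_center [of _ "q 0"] by blast
    \<comment> \<open>Pulling \<open>x\<close> back through \<open>n\<close> maps and comparing with
      \<open>q 0\<close> there: the bound \<open>M\<close> is halved at each level.\<close>
    have near: "\<exists>v\<in>sg_V q n. dist x v \<le> M * (1/2) ^ n" if "x \<in> K" for n x
      using that
    proof (induction n arbitrary: x)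
      case 0
      then show ?case using M by (auto simp: dist_commute)
    next
      case (Suc n)
      have "x \<in> (\<Union>i<3. sg_map q i ` K)" using Suc.prems by (subst (asm) K)
      then obtain i y where y: "i < 3" "y \<in> K" "x = sg_map q i y" by blast
      with Suc.IH obtain v where v: "v \<in> sg_V q n" "dist y v \<le> M * (1/2) ^ n" by blast
      then have "dist x (sg_map q i v) \<le> M * (1/2) ^ Suc n"
        unfolding y(3) dist_sg_map by simp
      then show ?case using sg_map_in_sg_V [OF y(1) v(1)] by blast
    qed
    have lim: "(\<lambda>n. M * (1/2) ^ n) \<longlonglongrightarrow> M * 0"
      by (intro tendsto_intros LIMSEQ_power_zero) simp
    show "x \<in> closure ?V"
      unfolding closure_approachable
    proof (intro allI impI)
      fix e :: real assume "e > 0"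
      with lim have "\<forall>\<^sub>F n in sequentially. M * (1/2) ^ n < e"
        by (intro order_tendstoD(2)) auto
      then obtain n where "M * (1/2) ^ n < e"
        using eventually_happens' sequentially_bot by blast
      with near [OF x, of n] show "\<exists>y\<in>?V. dist y x < e"
        by (force simp: dist_commute)
    qed
  qed
  ultimately show "K = closure ?V" by blast
qed

lemma sg_V_subset_SG: "sg_V q m \<subseteq> SG q"
  unfolding SG_eq_closure using closure_subset [of "\<Union>m. sg_V q m"] by blast

lemma corner_in_SG: "i < 3 \<Longrightarrow> q i \<in> SG q"
  using corner_in_sg_V sg_V_subset_SG by blast

lemma SG_subset_triangle: "SG q \<subseteq> triangle"
  unfolding SG_eq_closure using sg_V_subset_triangle closed_triangle
  by (intro closure_minimal) auto

lemma compact_SG: "compact (SG q)"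
  unfolding SG_eq_closure by (rule compact_closure_sg_V)

lemma SG_self_similar: "SG q = (\<Union>i<3. sg_map q i ` SG q)"
  unfolding SG_eq_closure sg_map_closure ..

lemma sg_map_in_SG: "i < 3 \<Longrightarrow> x \<in> SG q \<Longrightarrow> sg_map q i x \<in> SG q"
  by (subst SG_self_similar) auto

section \<open>Intersections of cells, and gluing along them\<close>

lemma cells_meet:
  assumes "i < 3" "j < 3" "i \<noteq> j" "x \<in> SG q" "y \<in> SG q" and eq: "sg_map q i x = sg_map q j y"
  shows "x = q j"
proof -
  have xy: "x \<in> triangle" "y \<in> triangle" using assms SG_subset_triangle by auto
  \<comment> \<open>Coordinate \<open>j\<close> is at most 1/2 on cell \<open>i\<close> and at least
    1/2 on cell \<open>j\<close>. A common point therefore forces \<open>bary j x = 1\<close>, so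
    the other coordinates vanish and \<open>x\<close> is the corner.\<close>
  have "bary j x / 2 = (bary j y + 1) / 2"
    using arg_cong [OF eq, of "bary j"] assms(1-3) by (simp add: bary_sg_map bary_corner)
  moreover have "bary j x \<le> 1" "bary j y \<ge> 0"
    using xy assms(2) bary_le_1 unfolding triangle_def by auto
  ultimately have 1: "bary j x = 1" by argo
  have "(\<Sum>k\<in>{..<3}-{j}. bary k x) = 0"
    using sum_bary [of x] sum.remove [of "{..<3}" j "\<lambda>k. bary k x"] assms(2) 1 by simp
  then have 0: "bary k x = 0" if "k < 3" "k \<noteq> j" for k
    using that xy(1) unfolding triangle_def by (subst (asm) sum_nonneg_eq_0_iff) auto
  have "(\<Sum>k<3. bary k x *\<^sub>R q k) = (\<Sum>k<3. if k = j then q k else 0)"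
    by (intro sum.cong) (auto simp: 0 1)
  moreover have "(\<Sum>k<3. bary k x *\<^sub>R q k) = x" using xy(1) unfolding triangle_def by auto
  ultimately show ?thesis using assms(2) by simp
qed

text \<open>The argument of \<open>v i\<close> is the preimage of \<open>x\<close> under
  \<open>sg_map q i\<close>. \<open>LEAST\<close> has a choice only at junctions, where
  \<open>compatible\<close> makes it immaterial.\<close>

definition glue :: "(nat \<Rightarrow> real^2 \<Rightarrow> real) \<Rightarrow> real^2 \<Rightarrow> real" where
  "glue v x = (let i = (LEAST i. x \<in> sg_map q i ` SG q) in v i (2 *\<^sub>R x - q i))"

definition compatible :: "(nat \<Rightarrow> real^2 \<Rightarrow> real) \<Rightarrow> bool" where
  "compatible v \<longleftrightarrow> (\<forall>i<3. \<forall>j<3. v i (q j) = v j (q i))"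

lemma glue_sg_map:
  assumes "compatible v" "i < 3" "x \<in> SG q"
  shows "glue v (sg_map q i x) = v i x"
proof -
  define j where "j = (LEAST j. sg_map q i x \<in> sg_map q j ` SG q)"
  have mem: "sg_map q i x \<in> sg_map q i ` SG q" using assms(3) by blast
  then have "sg_map q i x \<in> sg_map q j ` SG q" unfolding j_def by (rule LeastI)
  then obtain y where y: "y \<in> SG q" "sg_map q i x = sg_map q j y" by blast
  have "j \<le> i" unfolding j_def using mem by (rule Least_le)
  with assms(2) have j: "j < 3" by simp
  have "glue v (sg_map q i x) = v j (2 *\<^sub>R sg_map q j y - q j)"
    unfolding glue_def Let_def j_def [symmetric] by (simp only: y(2))
  also have "2 *\<^sub>R sg_map q j y - q j = y" by (simp add: sg_map_def)
  also have "v j y = v i x"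
  proof (cases "i = j")
    case False
    then have "x = q j" "y = q i"
      using cells_meet [OF assms(2) j _ assms(3) y(1) y(2)]
        cells_meet [OF j assms(2) _ y(1) assms(3) y(2) [symmetric]] by auto
    then show ?thesis using assms(1,2) j unfolding compatible_def by auto
  qed (use y in simp)
  finally show ?thesis .
qed

lemma continuous_on_glue:
  assumes "compatible v" "\<And>i. i < 3 \<Longrightarrow> continuous_on (SG q) (v i)"
  shows "continuous_on (SG q) (glue v)"
proof -
  have "continuous_on (\<Union>i\<in>{..<3}. sg_map q i ` SG q) (glue v)"
  proof (rule continuous_on_closed_Union)
    fix i :: nat assume "i \<in> {..<3}"
    then have i: "i < 3" by simp
    show "closed (sg_map q i ` SG q)"
      by (intro compact_imp_closed compact_continuous_image continuous_on_sg_map compact_SG)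
    have inv: "2 *\<^sub>R sg_map q i x - q i = x" for x by (simp add: sg_map_def)
    have "continuous_on (sg_map q i ` SG q) (\<lambda>x. v i (2 *\<^sub>R x - q i))"
      by (rule continuous_on_compose2 [OF assms(2) [OF i]])
        (auto intro!: continuous_intros simp: inv)
    then show "continuous_on (sg_map q i ` SG q) (glue v)"
      by (rule continuous_on_eq) (auto simp: glue_sg_map [OF assms(1) i] inv)
  qed simp
  then show ?thesis using SG_self_similar by simp
qed

end

section \<open>Energy and harmonic extension\<close>

lemma sum_lessThan_3: "(\<Sum>i<3::nat. f i) = f 0 + f 1 + (f 2 :: real)"
  unfolding lessThan_3 by simp

definition triangle_form :: "(nat \<Rightarrow> real) \<Rightarrow> real" where
  "triangle_form a = (a 0 - a 1)\<^sup>2 + (a 1 - a 2)\<^sup>2 + (a 2 - a 0)\<^sup>2"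

text \<open>The harmonic extension of boundary values \<open>a\<close> takes the value \<open>harmonic_step i a j\<close> at \<open>F\<^sub>i (q j)\<close>
  (the \<open>2/5\<close>--\<open>1/5\<close> rule).\<close>

definition harmonic_step :: "nat \<Rightarrow> (nat \<Rightarrow> real) \<Rightarrow> nat \<Rightarrow> real" where
  "harmonic_step i a j = (if i = j then a i else (a i + a j + (a 0 + a 1 + a 2)) / 5)"

lemma harmonic_step_commute: "harmonic_step i a j = harmonic_step j a i"
  by (simp add: harmonic_step_def add_ac)

text \<open>Origin of the factor 5/3: with the harmonic midpoint values, the unnormalised energy of
  the subdivided triangle is 3/5 of the original.\<close>

lemma triangle_form_harmonic_step:
  "5/3 * (\<Sum>i<3. triangle_form (harmonic_step i a)) = triangle_form a"
  unfolding triangle_form_def harmonic_step_def sum_lessThan_3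
  by (simp add: power2_eq_square, simp add: field_simps)

text \<open>Completing the square at the minimiser. The harmonic values are critical, so the
  deviations \<open>u\<close>, \<open>v\<close>, \<open>w\<close> enter without linear terms: each
  midpoint has two fixed corners and two other midpoints as neighbours.\<close>

lemma triangle_form_le:
  assumes "\<And>i. i < 3 \<Longrightarrow> b i i = a i" "\<And>i j. i < 3 \<Longrightarrow> j < 3 \<Longrightarrow> b i j = b j i"
  shows "triangle_form a \<le> 5/3 * (\<Sum>i<3. triangle_form (b i))"
proof -
  define u v w where "u = b 0 1 - harmonic_step 0 a 1" and "v = b 1 2 - harmonic_step 1 a 2"
    and "w = b 2 0 - harmonic_step 2 a 0"
  have b: "b 0 0 = a 0" "b 1 1 = a 1" "b 2 2 = a 2" "b 1 0 = b 0 1" "b 2 1 = b 1 2" "b 0 2 = b 2 0"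
    using assms by auto
  have "5/3 * (\<Sum>i<3. triangle_form (b i)) = triangle_form a
      + 5/3 * (2 * (u\<^sup>2 + v\<^sup>2 + w\<^sup>2) + (u - v)\<^sup>2 + (v - w)\<^sup>2 + (w - u)\<^sup>2)"
    unfolding triangle_form_def u_def v_def w_def harmonic_step_def sum_lessThan_3 b
    by (simp add: power2_eq_square, simp add: field_simps)
  then show ?thesis by simp
qed

text \<open>The extreme case compares corner \<open>i\<close> with a midpoint: the difference is
  \<open>(2 (a i - a j) + (a i - a k)) / 5\<close>, which gives the 3/5.\<close>

lemma harmonic_step_oscillation:
  assumes "\<And>j k. j < 3 \<Longrightarrow> k < 3 \<Longrightarrow> \<bar>a j - a k\<bar> \<le> B" "i < 3" "j < 3" "k < 3"
  shows "\<bar>harmonic_step i a j - harmonic_step i a k\<bar> \<le> 3/5 * B"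
proof -
  have "\<bar>a 0 - a 1\<bar> \<le> B" "\<bar>a 1 - a 2\<bar> \<le> B" "\<bar>a 2 - a 0\<bar> \<le> B"
    by (intro assms(1); simp)+
  then show ?thesis
    using assms(2-4) unfolding less_3_cases harmonic_step_def
    by (elim disjE) (simp_all, simp_all add: abs_le_iff field_simps)
qed

section \<open>Self-similarity and monotonicity of the energy levels\<close>

context gasket
begin

lemma corner_inject [simp]: "i < 3 \<Longrightarrow> j < 3 \<Longrightarrow> q i = q j \<longleftrightarrow> i = j"
  using bary_corner [of i i] bary_corner [of i j] by (auto split: if_splits)

lemma energy_level_cong:
  assumes "\<And>x. x \<in> sg_V q m \<Longrightarrow> u x = v x"
  shows "sg_energy_level q m u = sg_energy_level q m v"
proof -
  have "(\<Sum>(x, y)\<in>{(x, y). sg_adj q m x y}. (u x - u y)\<^sup>2) = (\<Sum>(x, y)\<in>{(x, y). sg_adj q m x y}. (v x - v y)\<^sup>2)"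
    by (intro sum.cong) (use assms sg_adj_in_sg_V in fastforce)+
  then show ?thesis unfolding sg_energy_level_def by simp
qed

lemma finite_sg_adj: "finite {(x, y). sg_adj q m x y}"
  by (rule finite_subset [of _ "sg_V q m \<times> sg_V q m"]) (auto dest: sg_adj_in_sg_V simp: finite_sg_V)

lemma energy_level_0: "sg_energy_level q 0 u = triangle_form (\<lambda>i. u (q i))"
proof -
  have ne: "q 0 \<noteq> q 1" "q 1 \<noteq> q 2" "q 2 \<noteq> q 0"
    by (subst corner_inject; simp)+
  then have "{(x, y). sg_adj q 0 x y} =
      {(q 0, q 1), (q 0, q 2), (q 1, q 0), (q 1, q 2), (q 2, q 0), (q 2, q 1)}"
    by (auto simp: sg_adj_0)
  then show ?thesis
    using ne by (simp add: sg_energy_level_def triangle_form_def,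
        simp add: power2_eq_square algebra_simps)
qed

text \<open>The edge sum splits over the cells, since an edge common to two cells would have both
  ends at their single junction.\<close>

lemma energy_level_Suc:
  "sg_energy_level q (Suc m) u = 5/3 * (\<Sum>i<3. sg_energy_level q m (\<lambda>x. u (sg_map q i x)))"
proof -
  let ?E = "{(x, y). sg_adj q m x y}"
  let ?F = "\<lambda>i. map_prod (sg_map q i) (sg_map q i)"
  have E: "{(x, y). sg_adj q (Suc m) x y} = (\<Union>i\<in>{..<3}. ?F i ` ?E)"
    unfolding sg_adj_Suc by auto
  have disj: "?F i ` ?E \<inter> ?F j ` ?E = {}" if ij: "i < 3" "j < 3" "i \<noteq> j" for i j
  proof (rule ccontr)
    assume "?F i ` ?E \<inter> ?F j ` ?E \<noteq> {}"
    then obtain x y x' y' where adj: "sg_adj q m x y" "sg_adj q m x' y'"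
      and eq: "sg_map q i x = sg_map q j x'" "sg_map q i y = sg_map q j y'" by auto
    have "x \<in> SG q" "y \<in> SG q" "x' \<in> SG q" "y' \<in> SG q"
      using adj sg_adj_in_sg_V sg_V_subset_SG by blast+
    then have "x = q j" "y = q j" using cells_meet ij eq by blast+
    then show False using adj(1) sg_adj_neq by blast
  qed
  have "(\<Sum>(x, y)\<in>{(x, y). sg_adj q (Suc m) x y}. (u x - u y)\<^sup>2)
      = (\<Sum>i<3. \<Sum>(x, y)\<in>?F i ` ?E. (u x - u y)\<^sup>2)"
    unfolding E using finite_sg_adj disj by (intro sum.UNION_disjoint) auto
  also have "\<dots> = (\<Sum>i<3. \<Sum>(x, y)\<in>?E. (u (sg_map q i x) - u (sg_map q i y))\<^sup>2)"
    by (rule sum.cong [OF refl], subst sum.reindex) (auto simp: inj_on_def case_prod_beta)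
  finally show ?thesis
    unfolding sg_energy_level_def sum_distrib_left [symmetric] by simp
qed

lemma energy_level_mono: "sg_energy_level q m u \<le> sg_energy_level q (Suc m) u"
proof (induction m arbitrary: u)
  case 0
  show ?case
    unfolding energy_level_Suc energy_level_0
    by (rule triangle_form_le) (simp_all, simp add: sg_map_corner_commute)
next
  case (Suc m)
  show ?case
    unfolding energy_level_Suc [of "Suc m"] energy_level_Suc [of m u]
    using Suc by (intro mult_left_mono sum_mono) auto
qed

lemma energy_level_le_energy: "ereal (sg_energy_level q m u) \<le> sg_energy q u"
proof -
  have inc: "incseq (\<lambda>m. ereal (sg_energy_level q m u))"
    by (rule incseq_SucI) (simp add: energy_level_mono)
  have "sg_energy q u = (SUP m. ereal (sg_energy_level q m u))"
    unfolding sg_energy_def by (rule limI, rule LIMSEQ_SUP, rule inc)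
  then show ?thesis by (metis SUP_upper UNIV_I)
qed

lemma energy_eqI:
  assumes "\<And>n. sg_energy_level q (m + n) u = e"
  shows "sg_energy q u = ereal e"
  unfolding sg_energy_def
proof (rule limI, rule tendsto_eventually)
  show "\<forall>\<^sub>F n in sequentially. ereal (sg_energy_level q n u) = ereal e"
    using eventually_ge_at_top [of m]
    by eventually_elim (metis assms le_add_diff_inverse)
qed

section \<open>Harmonic functions as limits of piecewise affine ones\<close>

primrec harmonic_approx :: "nat \<Rightarrow> (nat \<Rightarrow> real) \<Rightarrow> real^2 \<Rightarrow> real" where
  "harmonic_approx 0 a = (\<lambda>x. \<Sum>i<3. a i * bary i x)"
| "harmonic_approx (Suc k) a = glue (\<lambda>i. harmonic_approx k (harmonic_step i a))"

text \<open>Stage \<open>k\<close> carries the harmonic values on \<open>sg_V q k\<close> and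
  interpolates affinely in the cells of level \<open>k\<close>. Gluing the next stage needs
  compatibility, which is the corner formula of this stage, so both are proved together.\<close>

lemma harmonic_approx_corner: "j < 3 \<Longrightarrow> harmonic_approx k a (q j) = a j"
  and compatible_harmonic_approx: "compatible (\<lambda>i. harmonic_approx k (harmonic_step i a))"
proof -
  have *: "\<forall>a. \<forall>j<3. harmonic_approx k a (q j) = a j"
  proof (induction k)
    case 0
    have "(\<Sum>i<3. a i * bary i (q j)) = (\<Sum>i<3. if i = j then a i else 0)" if "j < 3" for j a
      using that by (intro sum.cong) (auto simp: bary_corner)
    then show ?case by simp
  next
    case (Suc k)
    have "compatible (\<lambda>i. harmonic_approx k (harmonic_step i a))" for a
      unfolding compatible_def using Suc harmonic_step_commute by simp
    from glue_sg_map [OF this] have "harmonic_approx (Suc k) a (sg_map q j (q j)) = a j" if "j < 3" for a j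
      using that Suc by (simp add: corner_in_SG harmonic_step_def del: sg_map_fixed)
    then show ?case by simp
  qed
  then show "j < 3 \<Longrightarrow> harmonic_approx k a (q j) = a j" by blast
  show "compatible (\<lambda>i. harmonic_approx k (harmonic_step i a))"
    unfolding compatible_def using * harmonic_step_commute by simp
qed

lemma harmonic_approx_Suc_sg_map:
  "i < 3 \<Longrightarrow> x \<in> SG q \<Longrightarrow>
    harmonic_approx (Suc k) a (sg_map q i x) = harmonic_approx k (harmonic_step i a) x"
  using glue_sg_map [OF compatible_harmonic_approx] by simp

lemma continuous_on_harmonic_approx: "continuous_on (SG q) (harmonic_approx k a)"
proof (induction k arbitrary: a)
  case 0
  show ?case by (auto intro!: continuous_intros continuous_on_bary)
next
  case (Suc k)
  then show ?case using continuous_on_glue [OF compatible_harmonic_approx] by simp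
qed

lemma harmonic_approx_0_near_corner:
  assumes "\<And>j k. j < 3 \<Longrightarrow> k < 3 \<Longrightarrow> \<bar>a j - a k\<bar> \<le> B" "i < 3" "x \<in> SG q"
  shows "\<bar>harmonic_approx 0 a x - a i\<bar> \<le> B"
proof -
  have nn: "bary j x \<ge> 0" if "j < 3" for j
    using that assms(3) SG_subset_triangle unfolding triangle_def by auto
  have "harmonic_approx 0 a x - a i = (\<Sum>j<3. a j * bary j x) - a i * (\<Sum>j<3. bary j x)"
    by (simp add: sum_bary)
  also have "\<dots> = (\<Sum>j<3. (a j - a i) * bary j x)"
    by (simp add: sum_distrib_left left_diff_distrib sum_subtractf)
  also have "\<bar>\<dots>\<bar> \<le> (\<Sum>j<3. B * bary j x)"
    by (rule order_trans [OF sum_abs], rule sum_mono)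
      (use nn assms(1,2) in \<open>auto simp: abs_mult intro!: mult_right_mono\<close>)
  also have "\<dots> = B" by (simp add: sum_distrib_left [symmetric] sum_bary)
  finally show ?thesis .
qed

text \<open>Passing to a cell shrinks the oscillation bound \<open>B\<close> by 3/5. At stage 0 the
  two functions lie within \<open>3/5 * B\<close> and \<open>B\<close> of the common value
  \<open>a i\<close>, and 8/5 is at most 2.\<close>

lemma harmonic_approx_diff:
  assumes "\<And>j k. j < 3 \<Longrightarrow> k < 3 \<Longrightarrow> \<bar>a j - a k\<bar> \<le> B" "x \<in> SG q"
  shows "\<bar>harmonic_approx (Suc k) a x - harmonic_approx k a x\<bar> \<le> 2 * B * (3/5) ^ k"
  using assms
proof (induction k arbitrary: a B x)
  case 0
  obtain i y where y: "i < 3" "y \<in> SG q" "x = sg_map q i y"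
    using "0.prems"(2) by (subst (asm) SG_self_similar) auto
  have "\<bar>harmonic_approx 0 (harmonic_step i a) y - harmonic_step i a i\<bar> \<le> 3/5 * B"
    using harmonic_step_oscillation [OF "0.prems"(1)] y by (intro harmonic_approx_0_near_corner) auto
  moreover have "\<bar>harmonic_approx 0 a x - a i\<bar> \<le> B"
    using "0.prems" y(1) by (intro harmonic_approx_0_near_corner) auto
  moreover have "harmonic_step i a i = a i" by (simp add: harmonic_step_def)
  moreover have "harmonic_approx (Suc 0) a x = harmonic_approx 0 (harmonic_step i a) y"
    unfolding y(3) using y(1,2) by (rule harmonic_approx_Suc_sg_map)
  moreover have "B \<ge> 0" using "0.prems"(1) [of 0 0] by simp
  ultimately show ?case unfolding abs_le_iff by simp
next
  case (Suc k)
  obtain i y where y: "i < 3" "y \<in> SG q" "x = sg_map q i y"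
    using Suc.prems(2) by (subst (asm) SG_self_similar) auto
  have "\<bar>harmonic_approx (Suc k) (harmonic_step i a) y - harmonic_approx k (harmonic_step i a) y\<bar>
      \<le> 2 * (3/5 * B) * (3/5) ^ k"
    using harmonic_step_oscillation [OF Suc.prems(1)] y(1,2) by (intro Suc.IH) auto
  then show ?case
    unfolding y(3) harmonic_approx_Suc_sg_map [OF y(1,2)] by simp
qed

definition harmonic :: "(nat \<Rightarrow> real) \<Rightarrow> real^2 \<Rightarrow> real" where
  "harmonic a x = lim (\<lambda>k. harmonic_approx k a x)"

text \<open>The successive differences are dominated by a geometric series, so the telescoping sum
  converges uniformly.\<close>

lemma uniform_limit_harmonic:
  "uniform_limit (SG q) (\<lambda>k. harmonic_approx k a) (harmonic a) sequentially"
proof -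
  define B where "B = \<bar>a 0 - a 1\<bar> + \<bar>a 1 - a 2\<bar> + \<bar>a 2 - a 0\<bar>"
  have B: "\<bar>a j - a k\<bar> \<le> B" if "j < 3" "k < 3" for j k
    using that unfolding less_3_cases B_def by (elim disjE) simp_all
  define d where "d k x = harmonic_approx (Suc k) a x - harmonic_approx k a x" for k x
  have "uniform_limit (SG q) (\<lambda>n x. \<Sum>k<n. d k x) (\<lambda>x. \<Sum>k. d k x) sequentially"
  proof (rule Weierstrass_m_test)
    show "norm (d k x) \<le> 2 * B * (3/5) ^ k" if "x \<in> SG q" for k x
      using harmonic_approx_diff [OF B that] unfolding d_def by simp
    show "summable (\<lambda>k. 2 * B * (3/5) ^ k)"
      by (intro summable_mult summable_geometric) simp
  qed
  then have "uniform_limit (SG q) (\<lambda>n x. harmonic_approx 0 a x + (\<Sum>k<n. d k x))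
      (\<lambda>x. harmonic_approx 0 a x + (\<Sum>k. d k x)) sequentially"
    by (intro uniform_limit_add uniform_limit_const)
  moreover have "harmonic_approx 0 a x + (\<Sum>k<n. d k x) = harmonic_approx n a x" for n x
    using sum_lessThan_telescope [of "\<lambda>k. harmonic_approx k a x" n] unfolding d_def by linarith
  ultimately have "uniform_limit (SG q) (\<lambda>n. harmonic_approx n a)
      (\<lambda>x. harmonic_approx 0 a x + (\<Sum>k. d k x)) sequentially"
    by simp
  then show ?thesis
    using uniformly_convergentI unfolding uniformly_convergent_uniform_limit_iff harmonic_def [abs_def]
    by blast
qed

lemma harmonic_approx_tendsto: "x \<in> SG q \<Longrightarrow> (\<lambda>k. harmonic_approx k a x) \<longlonglongrightarrow> harmonic a x"
  by (rule tendsto_uniform_limitI [OF uniform_limit_harmonic])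

lemma continuous_on_harmonic: "continuous_on (SG q) (harmonic a)"
  by (rule uniform_limit_theorem [OF _ uniform_limit_harmonic])
    (simp_all add: continuous_on_harmonic_approx)

lemma harmonic_corner: "j < 3 \<Longrightarrow> harmonic a (q j) = a j"
  using harmonic_approx_tendsto [OF corner_in_SG, of j a]
  by (simp add: harmonic_approx_corner LIMSEQ_const_iff)

lemma harmonic_sg_map:
  assumes "i < 3" "x \<in> SG q"
  shows "harmonic a (sg_map q i x) = harmonic (harmonic_step i a) x"
proof (rule LIMSEQ_unique)
  show "(\<lambda>k. harmonic_approx (Suc k) a (sg_map q i x)) \<longlonglongrightarrow> harmonic a (sg_map q i x)"
    using harmonic_approx_tendsto [OF sg_map_in_SG [OF assms]] by (rule LIMSEQ_Suc)
  show "(\<lambda>k. harmonic_approx (Suc k) a (sg_map q i x)) \<longlonglongrightarrow> harmonic (harmonic_step i a) x"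
    unfolding harmonic_approx_Suc_sg_map [OF assms] using assms(2) by (rule harmonic_approx_tendsto)
qed

text \<open>By \<open>triangle_form_harmonic_step\<close>, each refinement leaves the energy
  unchanged.\<close>

lemma energy_level_harmonic: "sg_energy_level q n (harmonic a) = triangle_form a"
proof (induction n arbitrary: a)
  case 0
  show ?case by (simp add: energy_level_0 triangle_form_def harmonic_corner)
next
  case (Suc n)
  have "sg_energy_level q n (\<lambda>x. harmonic a (sg_map q i x)) = triangle_form (harmonic_step i a)" if "i < 3" for i
    unfolding Suc [symmetric] using that sg_V_subset_SG
    by (intro energy_level_cong) (auto intro!: harmonic_sg_map)
  then show ?case
    unfolding energy_level_Suc triangle_form_harmonic_step [of a, symmetric] by simp
qed

text \<open>Recursion on the outermost map: \<open>g\<close> composed with \<open>sg_map q i\<close>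
  is extended cell by cell. The pieces agree at the junctions, where both carry the value of
  \<open>g\<close>.\<close>

lemma energy_preserving_extension:
  "\<exists>v. continuous_on (SG q) v \<and> (\<forall>x\<in>sg_V q m. v x = g x) \<and>
    (\<forall>n. sg_energy_level q (m + n) v = sg_energy_level q m g)"
proof (induction m arbitrary: g)
  case 0
  have "harmonic (\<lambda>i. g (q i)) x = g x" if "x \<in> sg_V q 0" for x
    using that harmonic_corner [of 0] harmonic_corner [of 1] harmonic_corner [of 2] by auto
  then show ?case
    using continuous_on_harmonic
    by (intro exI [of _ "harmonic (\<lambda>i. g (q i))"])
      (simp add: energy_level_harmonic energy_level_0 del: sg_V.simps)
next
  case (Suc m)
  have "\<forall>i. \<exists>v. continuous_on (SG q) v \<and> (\<forall>x\<in>sg_V q m. v x = g (sg_map q i x)) \<and>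
      (\<forall>n. sg_energy_level q (m + n) v = sg_energy_level q m (\<lambda>x. g (sg_map q i x)))"
    by (intro allI, rule Suc.IH)
  then obtain v where v: "\<And>i. continuous_on (SG q) (v i)"
    "\<And>i x. x \<in> sg_V q m \<Longrightarrow> v i x = g (sg_map q i x)"
    "\<And>i n. sg_energy_level q (m + n) (v i) = sg_energy_level q m (\<lambda>x. g (sg_map q i x))"
    by metis
  have comp: "compatible v"
    unfolding compatible_def by (simp add: v(2) corner_in_sg_V sg_map_corner_commute)
  have "glue v x = g x" if x: "x \<in> sg_V q (Suc m)" for x
  proof -
    from x obtain i y where y: "i < 3" "y \<in> sg_V q m" "x = sg_map q i y" by auto
    then have "y \<in> SG q" using sg_V_subset_SG by blast
    then show ?thesis unfolding y(3) using glue_sg_map [OF comp y(1)] v(2) y(2) by simp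
  qed
  moreover have "sg_energy_level q (Suc m + n) (glue v) = sg_energy_level q (Suc m) g" for n
  proof -
    have "sg_energy_level q (m + n) (\<lambda>x. glue v (sg_map q i x)) = sg_energy_level q (m + n) (v i)"
      if "i < 3" for i
      using glue_sg_map [OF comp that] sg_V_subset_SG by (intro energy_level_cong) blast
    then show ?thesis by (simp add: energy_level_Suc v(3))
  qed
  ultimately show ?case
    using continuous_on_glue [OF comp v(1)] by (intro exI [of _ "glue v"]) blast
qed

end

section \<open>Conductances\<close>

text \<open>Passes from the closure to the lists of \<open>sg_path\<close>; the empty chain
  corresponds to a one-point list.\<close>

lemma joined_through_iff_path:
  "joined_through R S x y \<longleftrightarrow>
    (\<exists>p. p \<noteq> [] \<and> set p \<subseteq> insert x (insert y S) \<and> successively R p \<and> hd p = x \<and> last p = y)"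
    (is "_ \<longleftrightarrow> (\<exists>p. ?path y p)")
proof
  define T where "T = insert x (insert y S)"
  assume "joined_through R S x y"
  then have "(\<lambda>a b. a \<in> T \<and> b \<in> T \<and> R a b)\<^sup>*\<^sup>* x y" unfolding joined_through_def T_def .
  then have "\<exists>p. p \<noteq> [] \<and> set p \<subseteq> T \<and> successively R p \<and> hd p = x \<and> last p = y"
  proof (induction rule: rtranclp_induct)
    case base
    show ?case by (intro exI [of _ "[x]"]) (simp add: T_def)
  next
    case (step b b')
    then obtain p where "p \<noteq> [] \<and> set p \<subseteq> T \<and> successively R p \<and> hd p = x \<and> last p = b" by blast
    with step.hyps(2) show ?case
      by (intro exI [of _ "p @ [b']"]) (auto simp: successively_append_iff)
  qed
  then show "\<exists>p. ?path y p" unfolding T_def .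
next
  define T where "T = insert x (insert y S)"
  assume "\<exists>p. ?path y p"
  then obtain p where p: "p \<noteq> []" "set p \<subseteq> T" "successively R p" "hd p = x" "last p = y"
    unfolding T_def by blast
  from p(1-3) have "(\<lambda>a b. a \<in> T \<and> b \<in> T \<and> R a b)\<^sup>*\<^sup>* (hd p) (last p)"
  proof (induction p)
    case (Cons a p)
    show ?case
    proof (cases p)
      case (Cons b p')
      with Cons.prems have "a \<in> T \<and> b \<in> T \<and> R a b" by auto
      moreover have "(\<lambda>a b. a \<in> T \<and> b \<in> T \<and> R a b)\<^sup>*\<^sup>* b (last p)"
        using Cons.IH Cons.prems Cons by simp
      ultimately have "(\<lambda>a b. a \<in> T \<and> b \<in> T \<and> R a b)\<^sup>*\<^sup>* a (last p)"
        by (rule converse_rtranclp_into_rtranclp [of "\<lambda>a b. a \<in> T \<and> b \<in> T \<and> R a b"])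
      then show ?thesis using Cons by simp
    qed simp
  qed simp
  then show "joined_through R S x y" unfolding joined_through_def p T_def .
qed

context gasket
begin

definition level_conductance :: "nat \<Rightarrow> real^2 \<Rightarrow> real^2 \<Rightarrow> real" where
  "level_conductance m x y = (if sg_adj q m x y then (5/3) ^ m else 0)"

lemma network_energy_level: "network_energy (sg_V q m) (level_conductance m) u = sg_energy_level q m u"
proof -
  let ?E = "{(x, y). sg_adj q m x y}"
  have sub: "?E \<subseteq> sg_V q m \<times> sg_V q m" using sg_adj_in_sg_V by auto
  have "(\<Sum>x\<in>sg_V q m. \<Sum>y\<in>sg_V q m. level_conductance m x y * (u x - u y)\<^sup>2)
      = (\<Sum>(x, y)\<in>sg_V q m \<times> sg_V q m. level_conductance m x y * (u x - u y)\<^sup>2)"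
    by (rule sum.cartesian_product)
  also have "\<dots> = (\<Sum>(x, y)\<in>?E. level_conductance m x y * (u x - u y)\<^sup>2)"
    by (rule sum.mono_neutral_right [OF _ sub]) (auto simp: finite_sg_V level_conductance_def split: if_splits)
  also have "\<dots> = (\<Sum>(x, y)\<in>?E. (5/3) ^ m * (u x - u y)\<^sup>2)"
    by (rule sum.cong [OF refl]) (auto simp: level_conductance_def)
  also have "\<dots> = (5/3) ^ m * (\<Sum>(x, y)\<in>?E. (u x - u y)\<^sup>2)"
    by (simp add: sum_distrib_left case_prod_beta)
  finally show ?thesis unfolding network_energy_def sg_energy_level_def by simp
qed

lemma conductance_eq_trace:
  assumes A: "A \<subseteq> sg_V q m"
    and tr: "trace_conductances (level_conductance m) (sg_V q m - A) A c"
    and xy: "x \<in> A" "y \<in> A" "x \<noteq> y"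
  shows "conductance q A x y = c x y"
proof -
  \<comment> \<open>The definite description demands 0 off \<open>A\<close> and on the diagonal,
    where the trace may leave other values; the energy on \<open>A\<close> does not see these
    entries.\<close>
  define d where "d x y = (if x \<in> A \<and> y \<in> A \<and> x \<noteq> y then c x y else 0)" for x y
  have finA: "finite A" using A finite_sg_V finite_subset by blast
  have Un: "sg_V q m - A \<union> A = sg_V q m" using A by blast
  note tr' = tr [unfolded trace_conductances_def Un network_energy_level]
  have csym: "c a b = c b a" for a b
    by (rule tr' [THEN conjunct1, rule_format])
  have dsym: "d a b = d b a" for a b
    unfolding d_def using csym [of a b] by auto
  have d0: "a \<notin> A \<or> b \<notin> A \<or> a = b \<Longrightarrow> d a b = 0" for a b
    unfolding d_def by auto
  have form: "network_energy A d u = network_energy A c u" for u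
    unfolding network_energy_def d_def
    by (intro arg_cong [where f = "\<lambda>t. (1/2) * t"] sum.cong refl) auto
  \<comment> \<open>Valid for every \<open>u\<close>, in the domain or not, because the energy is an
    extended real and dominates each level.\<close>
  have below: "ereal (network_energy A d u) \<le> sg_energy q u" for u
  proof -
    have "network_energy A d u \<le> sg_energy_level q m u"
      unfolding form by (rule tr' [THEN conjunct2, THEN conjunct2, THEN conjunct1, rule_format])
    then show ?thesis using energy_level_le_energy order_trans ereal_less_eq(3) by metis
  qed
  \<comment> \<open>The values are first extended optimally to \<open>sg_V q m\<close>, then to
    \<open>SG q\<close> at no cost in energy.\<close>
  have attained: "\<exists>v\<in>sg_dom q. (\<forall>a\<in>A. v a = f a) \<and> sg_energy q v = ereal (network_energy A d f)" for f
  proof -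
    obtain g where g: "\<forall>a\<in>A. g a = f a" "sg_energy_level q m g = network_energy A c f"
      using tr' [THEN conjunct2, THEN conjunct2, THEN conjunct2, THEN conjunct1, rule_format, of f] by blast
    obtain v where v: "continuous_on (SG q) v" "\<And>a. a \<in> sg_V q m \<Longrightarrow> v a = g a"
      "\<And>n. sg_energy_level q (m + n) v = sg_energy_level q m g"
      using energy_preserving_extension [of m g] by blast
    have "sg_energy q v = ereal (network_energy A d f)"
      using energy_eqI [OF v(3)] unfolding g(2) form .
    moreover from this have "v \<in> sg_dom q"
      unfolding sg_dom_def using v(1) by simp
    ultimately show ?thesis
      using v(2) g(1) A by (intro bexI [of _ v]) auto
  qed
  have least: "\<exists>u. least_energy q A f u" for f
  proof -
    obtain v where v: "v \<in> sg_dom q" "\<forall>a\<in>A. v a = f a" "sg_energy q v = ereal (network_energy A d f)"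
      using attained by blast
    have "sg_energy q v \<le> sg_energy q w" if "\<forall>a\<in>A. w a = f a" for w
      using below [of w] network_energy_cong [of A w f d] that unfolding v(3) by simp
    then show ?thesis using v(1,2) unfolding least_energy_def by blast
  qed
  have energy: "sg_energy q u = ereal (network_energy A d u)" if u: "least_energy q A f u" for f u
  proof (rule antisym)
    obtain v where v: "v \<in> sg_dom q" "\<forall>a\<in>A. v a = f a" "sg_energy q v = ereal (network_energy A d f)"
      using attained by blast
    then have "sg_energy q u \<le> ereal (network_energy A d f)"
      using u unfolding least_energy_def by metis
    also have "network_energy A d f = network_energy A d u"
      using u unfolding least_energy_def by (intro network_energy_cong) simp
    finally show "sg_energy q u \<le> ereal (network_energy A d u)" .
  qed (rule below)
  have "conductance q A = d"
    unfolding conductance_def network_energy_def [symmetric]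
  proof (rule the_equality)
    show "(\<forall>x y. d x y = d y x) \<and> (\<forall>x y. x \<notin> A \<or> y \<notin> A \<or> x = y \<longrightarrow> d x y = 0) \<and>
        (\<forall>f u. least_energy q A f u \<longrightarrow> sg_energy q u = ereal (network_energy A d u))"
      by (intro conjI allI impI) (rule dsym, erule d0, erule energy)
  next
    fix e
    assume e': "(\<forall>x y. e x y = e y x) \<and> (\<forall>x y. x \<notin> A \<or> y \<notin> A \<or> x = y \<longrightarrow> e x y = 0) \<and>
        (\<forall>f u. least_energy q A f u \<longrightarrow> sg_energy q u = ereal (network_energy A e u))"
    note e = e' [THEN conjunct1, rule_format] e' [THEN conjunct2, THEN conjunct1, rule_format]
      e' [THEN conjunct2, THEN conjunct2, rule_format]
    \<comment> \<open>The description constrains \<open>e\<close> only through minimisers. Since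
      every \<open>f\<close> admits one, the two energies agree on all functions and polarisation
      applies.\<close>
    have "network_energy A e f = network_energy A d f" for f
    proof -
      obtain u where u: "least_energy q A f u" using least by blast
      then have uf: "u a = f a" if "a \<in> A" for a using that unfolding least_energy_def by blast
      have "network_energy A e u = network_energy A d u" using e(3) [OF u] energy [OF u] by simp
      then show ?thesis
        using network_energy_cong [of A u f] uf by metis
    qed
    then have "e a b = d a b" if "a \<in> A" "b \<in> A" "a \<noteq> b" for a b
      using conductances_unique [where c = e and d = d, OF finA that e(1) dsym] by blast
    then show "e = d" using e(2) d0 by (intro ext) metis
  qed
  then show ?thesis using xy unfolding d_def by simp
qed

lemma conductance_eq_0_iff:
  assumes A: "A \<subseteq> sg_V q m" and xy: "x \<in> A" "y \<in> A" "x \<noteq> y"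
  shows "conductance q A x y = 0 \<longleftrightarrow> \<not> joined_through (sg_adj q m) (sg_V q m - A) x y"
proof -
  have "finite A" using A finite_sg_V finite_subset by blast
  moreover have "level_conductance m a b = level_conductance m b a" for a b
    unfolding level_conductance_def using sg_adj_sym by auto
  moreover have "level_conductance m a b \<ge> 0" for a b
    unfolding level_conductance_def by simp
  ultimately obtain c where c: "trace_conductances (level_conductance m) (sg_V q m - A) A c"
    using trace_conductances_exist [of "sg_V q m - A" A "level_conductance m"] finite_sg_V by blast
  have "(\<lambda>a b. level_conductance m a b > 0) = sg_adj q m"
    unfolding level_conductance_def by (intro ext) simp
  with c xy have "c x y > 0 \<longleftrightarrow> joined_through (sg_adj q m) (sg_V q m - A) x y" and "c x y \<ge> 0"
    unfolding trace_conductances_def by simp_all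
  then show ?thesis unfolding conductance_eq_trace [OF A c xy] by linarith
qed

end

theorem theorem2p2:
  fixes q :: "nat \<Rightarrow> real^2" and m :: nat and \<Gamma>' :: "(real^2) set" and x y :: "real^2"
  assumes "equilateral q"
    and "\<Gamma>' \<subseteq> sg_V q m"
    and "x \<in> \<Gamma>'" and "y \<in> \<Gamma>'" and "x \<noteq> y"
  shows "conductance q \<Gamma>' x y = 0 \<longleftrightarrow>
    (\<forall>p. sg_path q m x y p \<longrightarrow> (\<exists>z\<in>set p. z \<in> \<Gamma>' - {x, y}))"
proof -
  interpret gasket q by standard (rule assms(1))
  have "set p \<subseteq> insert x (insert y (sg_V q m - \<Gamma>')) \<longleftrightarrow>
      set p \<subseteq> sg_V q m \<and> \<not> (\<exists>z\<in>set p. z \<in> \<Gamma>' - {x, y})" for p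
    using assms(2-4) by blast
  then show ?thesis
    unfolding conductance_eq_0_iff [OF assms(2-5)] joined_through_iff_path sg_path_def by blast
qed

end
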